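(* Let $q$ be a prime power, $h\ge 1$, $k>3$, and let $C$ be an $\mathbb F_q$-linear $(n,q^{hk},n-k+1)_{q^h}$ MDS code over $\mathbb F_{q^h}$. Suppose there exist two subsets $A,B\subset[1,n]$ with $A\cap B=\varnothing$ and $|A|+|B|\le k-2$ such that the projections of $C$ from $A$ and from $B$ are $\mathbb F_q$-equivalent to linear codes. If $n>q+k$, then $C$ is $\mathbb F_q$-equivalent to an $\mathbb F_{q^s}$-linear code for some divisor $s>1$ of $h$. Moreover, if $n>q^e+k$, where $e$ is the largest divisor of $h$ strictly smaller than $h$, then $C$ is $\mathbb F_q$-equivalent to a linear code.
   Context: A code of length $n$ over $\mathbb F_{q^h}$ is a subset of $\mathbb F_{q^h}^n$; an $(n,M,d)_{q^h}$ code has $M$ codewords and minimum Hamming distance $d$. It is $\mathbb F_{q^s}$-linear (for a subfield $\mathbb F_{q^s}$) if it is an $\mathbb F_{q^s}$-subspace of $\mathbb F_{q^h}^n$, and linear if it is an $\mathbb F_{q^h}$-subspace. It is MDS if $M=q^{h(n-d+1)}$. Two $\mathbb F_q$-linear codes over $\mathbb F_{q^h}$ are $\mathbb F_q$-equivalent if one is obtained from the other by permuting coordinate positions and applying, in each coordinate position, an $\mathbb F_q$-linear bijection of $\mathbb F_{q^h}$ (possibly different in different positions). The projection of $C$ from position $i$ is $\{(x_1,\dots,x_{i-1},x_{i+1},\dots,x_n) : (x_1,\dots,x_{i-1},0,x_{i+1},\dots,x_n)\in C\}$; the projection from a set of positions is obtained by projecting consecutively from each of its positions. *)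

theory Defs
  imports "HOL-Computational_Algebra.Primes"
begin

definition words :: "nat set \<Rightarrow> (nat \<Rightarrow> 'a::zero) set" where
  "words I = {x. \<forall>i. i \<notin> I \<longrightarrow> x i = 0}"

definition prime_power :: "nat \<Rightarrow> bool" where
  "prime_power q \<longleftrightarrow> (\<exists>p m. prime p \<and> m \<ge> 1 \<and> q = p ^ m)"

text \<open>The subfield of order q^s of a finite field of order q^h (s dvd h).\<close>
definition subfield_ord :: "nat \<Rightarrow> 'a::field set" where
  "subfield_ord Q = {x. x ^ Q = x}"

definition lin_code :: "'a::field set \<Rightarrow> nat set \<Rightarrow> (nat \<Rightarrow> 'a) set \<Rightarrow> bool" where
  "lin_code K I C \<longleftrightarrow> C \<subseteq> words I \<and> (\<lambda>_. 0) \<in> C \<and>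
     (\<forall>x\<in>C. \<forall>y\<in>C. (\<lambda>i. x i + y i) \<in> C) \<and>
     (\<forall>c\<in>K. \<forall>x\<in>C. (\<lambda>i. c * x i) \<in> C)"

definition hdist :: "nat set \<Rightarrow> (nat \<Rightarrow> 'a) \<Rightarrow> (nat \<Rightarrow> 'a) \<Rightarrow> nat" where
  "hdist I x y = card {i\<in>I. x i \<noteq> y i}"

definition min_dist :: "nat set \<Rightarrow> (nat \<Rightarrow> 'a) set \<Rightarrow> nat" where
  "min_dist I C = Min {hdist I x y | x y. x \<in> C \<and> y \<in> C \<and> x \<noteq> y}"

definition is_code :: "nat set \<Rightarrow> (nat \<Rightarrow> 'a::zero) set \<Rightarrow> nat \<Rightarrow> nat \<Rightarrow> bool" where
  "is_code I C M d \<longleftrightarrow> C \<subseteq> words I \<and> card C = M \<and> min_dist I C = d"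

definition Fq_linear_map :: "'a::field set \<Rightarrow> ('a \<Rightarrow> 'a) \<Rightarrow> bool" where
  "Fq_linear_map K f \<longleftrightarrow> (\<forall>x y. f (x + y) = f x + f y) \<and> (\<forall>c\<in>K. \<forall>x. f (c * x) = c * f x)"

definition code_equiv :: "'a::field set \<Rightarrow> nat set \<Rightarrow> (nat \<Rightarrow> 'a) set \<Rightarrow> (nat \<Rightarrow> 'a) set \<Rightarrow> bool" where
  "code_equiv K I C D \<longleftrightarrow> (\<exists>\<sigma> \<phi>. bij_betw \<sigma> I I \<and>
      (\<forall>i\<in>I. bij (\<phi> i) \<and> Fq_linear_map K (\<phi> i)) \<and>
      D = (\<lambda>x. \<lambda>j. if j \<in> I then \<phi> j (x (\<sigma> j)) else 0) ` C)"

text \<open>Projection from a set A of positions: codewords vanishing on A, viewed on coordinates I - A.\<close>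
definition proj :: "nat set \<Rightarrow> (nat \<Rightarrow> 'a::zero) set \<Rightarrow> (nat \<Rightarrow> 'a) set" where
  "proj A C = {x\<in>C. \<forall>i\<in>A. x i = 0}"

end

theory Submission
  imports Defs "HOL-Computational_Algebra.Polynomial" "HOL-Library.FuncSet"
begin

text \<open>
  Enlarge \<open>A\<close> and \<open>B\<close> to a set \<open>S\<close> of \<open>k - 2\<close> positions. The codewords vanishing on \<open>S\<close>
  form a two-dimensional MDS code that both given equivalences \<open>\<phi>\<close>, \<open>\<psi>\<close> turn into linear codes.
  Comparing the two linear structures, \<open>\<phi>\<close> and \<open>\<psi>\<close> differ in each position outside \<open>S\<close> by the
  same map \<open>\<rho>\<close> up to scalars, and each of the \<open>n - k\<close> remaining positions contributes a different
  nonzero scalar \<open>c\<close> such that \<open>\<rho>\<^sup>-\<^sup>1 c \<rho>\<close> is again multiplication by a scalar. These scalars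
  form a subfield \<open>L\<close>, which thus has more than \<open>n - k\<close> elements. Every codeword is a sum of one
  vanishing on \<open>A\<close> and one vanishing on \<open>B\<close>, and \<open>L\<close> acts compatibly on both, so the code is
  equivalent to an \<open>L\<close>-linear one.
\<close>

section \<open>Subfields of a finite field\<close>

text \<open>A set inside the ambient field rather than a type, so that subfields can be compared by
  inclusion. The convention \<open>inverse 0 = 0\<close> lets the inverse clause range over all of
  \<open>L\<close>.\<close>

definition is_subfield :: "'a::field set \<Rightarrow> bool" where
  "is_subfield L \<longleftrightarrow> 0 \<in> L \<and> 1 \<in> L \<and> (\<forall>x\<in>L. \<forall>y\<in>L. x + y \<in> L \<and> x * y \<in> L)
     \<and> (\<forall>x\<in>L. - x \<in> L \<and> inverse x \<in> L)"

lemma prime_power_ge_2: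
  assumes "prime_power q"
  shows "2 \<le> q"
proof -
  obtain p m where p: "prime p" "m \<ge> 1" "q = p ^ m"
    using assms by (auto simp: prime_power_def)
  then have "p ^ 1 \<le> q" by (metis power_increasing prime_ge_1_nat)
  then show ?thesis using prime_ge_2_nat[OF p(1)] by simp
qed

text \<open>Multiplication by a nonzero \<open>x\<close> permutes the nonzero elements of
  \<open>L\<close>; comparing their product before and after gives
  \<open>x ^ (card L - 1) = 1\<close>.\<close>

lemma power_card_subfield:
  fixes L :: "'a::{field,finite} set"
  assumes L: "is_subfield L" and x: "x \<in> L"
  shows "x ^ card L = x"
proof (cases "x = 0")
  case True
  then show ?thesis using x by (auto simp: power_0_left)
next
  case False
  have "(\<Prod>y\<in>L-{0}. x * y) = (\<Prod>y\<in>L-{0}. y)"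
    by (rule prod.reindex_bij_witness[of _ "\<lambda>y. y * inverse x" "\<lambda>y. x * y"])
      (use False L x in \<open>auto simp: is_subfield_def\<close>)
  then have "x ^ card (L - {0}) * (\<Prod>y\<in>L-{0}. y) = (\<Prod>y\<in>L-{0}. y)"
    by (simp add: prod.distrib)
  then have "x ^ card (L - {0}) = 1" by simp
  moreover have "card L = Suc (card (L - {0}))"
    using L by (intro card.remove) (auto simp: is_subfield_def)
  ultimately show ?thesis by simp
qed

lemma subfield_UNIV: "is_subfield UNIV"
  by (simp add: is_subfield_def)

text \<open>The elements are the roots of \<open>X^Q - X\<close>, a nonzero polynomial of degree
  \<open>Q\<close>.\<close>

lemma card_subfield_ord_le:
  assumes "Q \<ge> 2"
  shows "card (subfield_ord Q :: 'a::field set) \<le> Q"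
proof -
  let ?p = "monom 1 Q - monom 1 1 :: 'a poly"
  have "coeff ?p Q = 1" using assms by simp
  then have "?p \<noteq> 0" by (metis coeff_0 zero_neq_one)
  from card_poly_roots_bound[OF this]
  have "card {x. poly ?p x = 0} \<le> degree ?p" .
  also have "degree ?p \<le> Q"
    using assms by (intro degree_diff_le) (auto simp: degree_monom_eq)
  also have "{x. poly ?p x = 0} = subfield_ord Q"
    by (auto simp: subfield_ord_def poly_monom)
  finally show ?thesis .
qed

text \<open>The elements outside the fixed field are roots of the cofactor
  \<open>(X^(q^h-1) - 1) / (X^(q-1) - 1)\<close>, whose degree is \<open>q^h - q\<close>.\<close>

lemma card_subfield_ord_base:
  assumes q: "q \<ge> 2" and h: "h \<ge> 1" and card: "card (UNIV :: 'a::{field,finite} set) = q ^ h"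
  shows "card (subfield_ord q :: 'a set) = q"
proof (rule antisym)
  show "card (subfield_ord q :: 'a set) \<le> q"
    by (rule card_subfield_ord_le[OF q])
  \<comment> \<open>Here \<open>m\<close> is the geometric sum \<open>(q^h - 1) / (q - 1)\<close>.
    The cofactor \<open>P\<close> below is a geometric sum in \<open>X^N\<close>, of degree at most
    \<open>N * (m - 1)\<close>.\<close>
  define N m where "N = q - 1" and "m = (\<Sum>i<h. q ^ i)"
  have "int (N * m) = int (q ^ h) - 1"
    using q unfolding N_def m_def by (simp add: of_nat_diff power_diff_1_eq)
  then have Nm: "q ^ h = N * m + 1" by linarith
  have "q ^ 1 \<le> q ^ h" using q h by (intro power_increasing) auto
  then have m: "m \<ge> 1" using q Nm by (cases m) auto
  define P :: "'a poly" where "P = (\<Sum>i<m. monom 1 (N * i))"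
  have deg: "degree P \<le> N * (m - 1)"
    unfolding P_def
    by (intro degree_sum_le) (auto simp: degree_monom_eq)
  have P: "poly P x = (\<Sum>i<m. (x ^ N) ^ i)" for x
    by (simp add: P_def poly_sum poly_monom power_mult)
  have "poly P 0 = 1"
  proof -
    have "poly P 0 = (\<Sum>i<m. 0 ^ i)"
      using q by (simp add: P N_def power_0_left)
    also have "\<dots> = 1" using m by (simp add: power_0_left)
    finally show ?thesis .
  qed
  then have "P \<noteq> 0" by auto
  have "UNIV \<subseteq> subfield_ord q \<union> {x. poly P x = 0}"
  proof
    fix x :: 'a
    show "x \<in> subfield_ord q \<union> {x. poly P x = 0}"
    proof (cases "x = 0")
      case True
      then show ?thesis using q by (simp add: subfield_ord_def)
    next
      case False
      have "x ^ (N * m + 1) = x"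
        using power_card_subfield[OF subfield_UNIV, of x] card Nm by simp
      then have "x ^ (N * m) = 1" using False by simp
      then have "(x ^ N - 1) * poly P x = 0"
        using power_diff_1_eq[of "x ^ N" m] by (simp add: P power_mult)
      moreover have "x ^ N = 1 \<Longrightarrow> x ^ q = x"
        using q by (simp add: N_def power_eq_if)
      ultimately show ?thesis by (auto simp: subfield_ord_def)
    qed
  qed
  \<comment> \<open>Of the \<open>N * m + 1\<close> field elements at most
    \<open>N * (m - 1)\<close> are roots of \<open>P\<close>, which leaves at least
    \<open>N + 1 = q\<close> for the fixed field.\<close>
  then have "q ^ h \<le> card (subfield_ord q \<union> {x :: 'a. poly P x = 0})"
    unfolding card[symmetric] by (intro card_mono) auto
  also have "\<dots> \<le> card (subfield_ord q :: 'a set) + card {x. poly P x = 0}"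
    by (rule card_Un_le)
  also have "card {x. poly P x = 0} \<le> N * (m - 1)"
    using card_poly_roots_bound[OF \<open>P \<noteq> 0\<close>] deg by linarith
  finally have "N * m + 1 \<le> card (subfield_ord q :: 'a set) + N * (m - 1)"
    using Nm by linarith
  moreover have "N * m = N * (m - 1) + N" using m by (cases m) auto
  ultimately show "q \<le> card (subfield_ord q :: 'a set)"
    using q unfolding N_def by linarith
qed

text \<open>Translation by 1 permutes the field, so summing \<open>x + 1\<close> or \<open>x\<close>
  over it gives the same value. This ties the characteristic to the order of the field.\<close>

lemma of_nat_card_UNIV_eq_0: "of_nat (card (UNIV :: 'a::{field,finite} set)) = (0 :: 'a)"
proof -
  have "(\<Sum>x\<in>UNIV. x + 1) = (\<Sum>x\<in>UNIV. x :: 'a)"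
    by (rule sum.reindex_bij_witness[of _ "\<lambda>x. x - 1" "\<lambda>x. x + 1"]) auto
  then show ?thesis by (simp add: sum.distrib)
qed

text \<open>Since \<open>q\<close> is a power of the characteristic, raising to the power
  \<open>q\<close> is additive as well as multiplicative, and its fixed points form a
  subfield.\<close>

lemma subfield_ord_subfield:
  assumes q: "prime_power q" and card: "card (UNIV :: 'a::{field,finite} set) = q ^ h"
  shows "is_subfield (subfield_ord q :: 'a set)"
proof -
  obtain p m where p: "prime p" "m \<ge> 1" "q = p ^ m"
    using q by (auto simp: prime_power_def)
  have "CHAR('a) > 0" by (rule finite_imp_CHAR_pos) simp
  then have "prime CHAR('a)" by (rule prime_CHAR_semidom)
  have "CHAR('a) dvd p ^ (m * h)"
    using of_nat_card_UNIV_eq_0[where 'a = 'a] unfolding of_nat_eq_0_iff_char_dvd card p(3)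
    by (simp only: power_mult)
  then have "CHAR('a) = p"
    using \<open>prime CHAR('a)\<close> p by (metis prime_dvd_power primes_dvd_imp_eq)
  then have add: "(x + y) ^ q = x ^ q + y ^ q" for x y :: 'a
    using freshmans_dream'[OF \<open>prime CHAR('a)\<close>, of q m x y] p by simp
  have "q > 0" using p by (simp add: prime_gt_0_nat)
  \<comment> \<open>Deriving the sign rule from additivity covers even and odd \<open>q\<close>
    together.\<close>
  then have "x ^ q + (- x) ^ q = 0" for x :: 'a
    using add[of x "- x"] by (simp add: power_0_left)
  then have "(- x) ^ q = - (x ^ q)" for x :: 'a
    by (metis add.inverse_unique)
  then show ?thesis
    using \<open>q > 0\<close>
    by (auto simp: is_subfield_def subfield_ord_def add power_mult_distrib power_inverse)
qed

text \<open>Among the \<open>K\<close>-subspaces of \<open>W\<close> whose order is a power of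
  \<open>card K\<close>, a largest one is all of \<open>W\<close>, since adjoining a further vector
  multiplies the order by \<open>card K\<close>.\<close>

lemma card_subspace_power:
  fixes K W :: "'a::{field,finite} set"
  assumes K: "is_subfield K" and W0: "0 \<in> W"
    and Wadd: "\<And>x y. x \<in> W \<Longrightarrow> y \<in> W \<Longrightarrow> x + y \<in> W"
    and Wscale: "\<And>c x. c \<in> K \<Longrightarrow> x \<in> W \<Longrightarrow> c * x \<in> W"
  shows "\<exists>s. card W = card K ^ s"
proof -
  define good where "good V \<longleftrightarrow> V \<subseteq> W \<and> 0 \<in> V \<and> (\<forall>x\<in>V. \<forall>y\<in>V. x + y \<in> V) \<and>
     (\<forall>c\<in>K. \<forall>x\<in>V. c * x \<in> V) \<and> (\<exists>s. card V = card K ^ s)" for V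
  have "good {0}"
    unfolding good_def using W0 by (intro conjI exI[of _ 0]) auto
  moreover have "\<forall>V. good V \<longrightarrow> card V < Suc (card W)"
    by (auto simp: good_def less_Suc_eq_le intro: card_mono)
  ultimately have "\<exists>V. good V \<and> (\<forall>V'. good V' \<longrightarrow> card V' \<le> card V)"
    by (rule ex_has_greatest_nat)
  then obtain V where V: "good V" and max: "\<And>V'. good V' \<Longrightarrow> card V' \<le> card V"
    by blast
  obtain s where s: "card V = card K ^ s" using V by (auto simp: good_def)
  have minus: "- x \<in> V" if "x \<in> V" for x
  proof -
    have "(- 1) * x \<in> V" using V that K unfolding good_def is_subfield_def by blast
    then show ?thesis by simp
  qed
  have "W \<subseteq> V"
  proof (rule ccontr)
    assume "\<not> W \<subseteq> V"
    then obtain x where x: "x \<in> W" "x \<notin> V" by auto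
    let ?f = "\<lambda>(c, v). c * x + v"
    let ?V = "?f ` (K \<times> V)"
    \<comment> \<open>If two pairs collide with \<open>a \<noteq> b\<close>, dividing by
      \<open>a - b\<close> puts \<open>x\<close> into \<open>V\<close>.\<close>
    have "inj_on ?f (K \<times> V)"
    proof (rule inj_onI, clarsimp)
      fix a b v w assume *: "a \<in> K" "b \<in> K" "v \<in> V" "w \<in> V" "a * x + v = b * x + w"
      then have eq: "(a - b) * x = w + - v" by (simp add: algebra_simps)
      moreover have "w + - v \<in> V" using * minus V unfolding good_def by blast
      ultimately have mem: "(a - b) * x \<in> V" by metis
      have "a - b \<in> K" using * K unfolding is_subfield_def
        by (metis add_uminus_conv_diff)
      then have "inverse (a - b) * ((a - b) * x) \<in> V"
        using mem K V unfolding good_def is_subfield_def by blast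
      then have "a = b" using x by (cases "a = b") (auto simp flip: mult.assoc)
      then show "a = b \<and> v = w" using eq by simp
    qed
    then have c: "card ?V = card K * card V"
      by (simp add: card_image card_cartesian_product)
    have "good ?V"
      unfolding good_def
    proof (intro conjI ballI)
      show "?V \<subseteq> W" using x V Wadd Wscale by (auto simp: good_def)
      show "0 \<in> ?V" using V K by (intro image_eqI[of _ _ "(0, 0)"]) (auto simp: good_def is_subfield_def)
      show "\<exists>s. card ?V = card K ^ s" by (rule exI[of _ "Suc s"]) (simp add: c s)
    next
      fix y z assume "y \<in> ?V" "z \<in> ?V"
      then obtain a v b w where *: "a \<in> K" "v \<in> V" "b \<in> K" "w \<in> V" "y = a * x + v" "z = b * x + w"
        by auto
      then have "y + z = ?f (a + b, v + w)" by (simp add: algebra_simps)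
      moreover have "(a + b, v + w) \<in> K \<times> V"
        using * K V by (auto simp: good_def is_subfield_def)
      ultimately show "y + z \<in> ?V" by blast
    next
      fix c y assume "c \<in> K" "y \<in> ?V"
      then obtain a v where *: "a \<in> K" "v \<in> V" "y = a * x + v" by auto
      then have "c * y = ?f (c * a, c * v)" by (simp add: algebra_simps)
      moreover have "(c * a, c * v) \<in> K \<times> V"
        using * \<open>c \<in> K\<close> K V by (auto simp: good_def is_subfield_def)
      ultimately show "c * y \<in> ?V" by blast
    qed
    then have "card K * card V \<le> card V" using max c by metis
    moreover have "card V > 0" using V by (auto simp: good_def card_gt_0_iff)
    moreover have "card K \<ge> card {0, 1 :: 'a}"
      using K by (intro card_mono) (auto simp: is_subfield_def)
    ultimately show False by simp
  qed
  then have "W = V" using V by (auto simp: good_def)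
  then show ?thesis using s by blast
qed

text \<open>Counting \<open>L\<close> over the base field gives \<open>q ^ s\<close>, and counting
  the whole field over \<open>L\<close> gives \<open>s dvd h\<close>. Every element of
  \<open>L\<close> is fixed by the power \<open>q ^ s\<close>, which has at most
  \<open>q ^ s\<close> fixed points.\<close>

lemma subfield_eq_subfield_ord:
  fixes L :: "'a::{field,finite} set"
  assumes q: "prime_power q" and h: "h \<ge> 1" and card: "card (UNIV :: 'a set) = q ^ h"
    and L: "is_subfield L" and KL: "subfield_ord q \<subseteq> L"
  obtains s where "s dvd h" "card L = q ^ s" "L = subfield_ord (q ^ s)"
proof -
  note q2 = prime_power_ge_2[OF q]
  note K = subfield_ord_subfield[OF q card]
  have "\<exists>s. card L = card (subfield_ord q :: 'a set) ^ s"
    using L KL by (intro card_subspace_power[OF K]) (auto simp: is_subfield_def)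
  then obtain s where s: "card L = q ^ s"
    using card_subfield_ord_base[OF q2 h card] by auto
  have "\<exists>m. card (UNIV :: 'a set) = card L ^ m"
    by (intro card_subspace_power[OF L]) auto
  then obtain m where "q ^ h = q ^ (s * m)" using s card by (auto simp: power_mult)
  then have "h = s * m" using q2 by simp
  have "card L \<ge> card {0, 1 :: 'a}"
    using L by (intro card_mono) (auto simp: is_subfield_def)
  then have "q ^ s \<ge> 2" using s by simp
  from card_subfield_ord_le[OF this] have "card (subfield_ord (q ^ s) :: 'a set) \<le> card L"
    using s by simp
  moreover have "L \<subseteq> subfield_ord (q ^ s)"
    using power_card_subfield[OF L] s by (auto simp: subfield_ord_def)
  ultimately have "L = subfield_ord (q ^ s)" by (intro card_seteq) auto
  then show ?thesis using that[of s] \<open>h = s * m\<close> s by simp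
qed

section \<open>Linearizations of shortened MDS codes\<close>

lemma Fq_linear_map_0: "Fq_linear_map K f \<Longrightarrow> f 0 = 0"
  unfolding Fq_linear_map_def by (metis add_0 add_cancel_right_right)

lemma Fq_linear_map_inv:
  assumes "bij f" "Fq_linear_map K f"
  shows "Fq_linear_map K (inv f)"
proof -
  have f: "f (inv f x) = x" "inv f (f x) = x" for x
    using assms(1) by (simp_all add: bij_is_surj surj_f_inv_f bij_is_inj)
  have "inv f (x + y) = inv f x + inv f y" for x y
  proof -
    have "f (inv f x + inv f y) = x + y" using assms(2) by (simp add: Fq_linear_map_def f(1))
    then show ?thesis using f(2) by metis
  qed
  moreover have "inv f (c * x) = c * inv f x" if "c \<in> K" for c x
  proof -
    have "f (c * inv f x) = c * x" using assms(2) that by (simp add: Fq_linear_map_def f(1))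
    then show ?thesis using f(2) by metis
  qed
  ultimately show ?thesis by (simp add: Fq_linear_map_def)
qed

text \<open>The MDS property is kept in two forms: a codeword with \<open>k\<close> zeros vanishes
  (\<open>eq_zero\<close>), and the values at up to \<open>k\<close> positions can be prescribed
  (\<open>interpolate\<close>).\<close>

locale mds_code =
  fixes K :: "'a::{field,finite} set" and n k :: nat and C :: "(nat \<Rightarrow> 'a) set"
  assumes lin: "lin_code K {0..<n} C"
    and minus_closed: "x \<in> C \<Longrightarrow> y \<in> C \<Longrightarrow> (\<lambda>i. x i - y i) \<in> C"
    and eq_zero: "x \<in> C \<Longrightarrow> S \<subseteq> {0..<n} \<Longrightarrow> k \<le> card S \<Longrightarrow> \<forall>i\<in>S. x i = 0 \<Longrightarrow> x = (\<lambda>_. 0)"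
    and interpolate: "S \<subseteq> {0..<n} \<Longrightarrow> card S \<le> k \<Longrightarrow> k \<le> n \<Longrightarrow> \<exists>x\<in>C. \<forall>i\<in>S. x i = t i"
begin

lemma add_closed: "x \<in> C \<Longrightarrow> y \<in> C \<Longrightarrow> (\<lambda>i. x i + y i) \<in> C"
  using lin by (simp add: lin_code_def)

lemma zero_mem: "(\<lambda>_. 0) \<in> C"
  using lin by (simp add: lin_code_def)

lemma eqI:
  assumes "x \<in> C" "y \<in> C" "S \<subseteq> {0..<n}" "k \<le> card S" "\<And>i. i \<in> S \<Longrightarrow> x i = y i"
  shows "x = y"
  using eq_zero[OF minus_closed[OF assms(1,2)] assms(3,4)] assms(5)
  by (auto simp: fun_eq_iff)

text \<open>\<open>S\<close> together with \<open>u\<close> and \<open>w\<close> has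
  \<open>k\<close> positions: the codewords vanishing on \<open>S\<close> behave like a
  two-dimensional MDS code, where any two coordinates determine the word.\<close>

lemma eqI_points:
  assumes S: "S \<subseteq> {0..<n}" "card S + 2 = k"
    and uw: "u \<in> {0..<n} - S" "w \<in> {0..<n} - S" "u \<noteq> w"
    and x: "x \<in> C" "\<forall>j\<in>S. x j = 0" and y: "y \<in> C" "\<forall>j\<in>S. y j = 0"
    and xy: "x u = y u" "x w = y w"
  shows "x = y"
proof (rule eqI[OF x(1) y(1), of "insert u (insert w S)"])
  have "finite S" using S finite_subset by blast
  then show "k \<le> card (insert u (insert w S))" using uw S by simp
  show "insert u (insert w S) \<subseteq> {0..<n}" using uw S by blast
  show "x i = y i" if "i \<in> insert u (insert w S)" for i
    using that x y xy by auto
qed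

lemma interpolate_point:
  assumes S: "S \<subseteq> {0..<n}" "card S + 2 = k" "k \<le> n"
    and uw: "u \<in> {0..<n} - S" "w \<in> {0..<n} - S" "u \<noteq> w"
  obtains x where "x \<in> C" "x u = a" "x w = 0" "\<forall>j\<in>S. x j = 0"
proof -
  have "finite S" using S finite_subset by blast
  then have "card (insert u (insert w S)) \<le> k" using uw S by simp
  moreover have "insert u (insert w S) \<subseteq> {0..<n}" using uw S by blast
  ultimately obtain x where x: "x \<in> C" "\<forall>j\<in>insert u (insert w S). x j = (if j = u then a else 0)"
    using interpolate[of _ "\<lambda>j. if j = u then a else 0"] S(3) by blast
  have "x u = a" "x w = 0" using x(2) uw(3) by simp_all
  moreover have "x j = 0" if "j \<in> S" for j
  proof -
    have "x j = (if j = u then a else 0)" using x(2) that by blast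
    moreover have "j \<noteq> u" using uw that by blast
    ultimately show ?thesis by simp
  qed
  ultimately show ?thesis using that[OF x(1)] by blast
qed

text \<open>No permutation of positions appears here: the one in \<^const>\<open>code_equiv\<close> is absorbed by
  reindexing \<open>\<phi>\<close>.\<close>

definition linearizes :: "nat set \<Rightarrow> (nat \<Rightarrow> 'a \<Rightarrow> 'a) \<Rightarrow> bool" where
  "linearizes A \<phi> \<longleftrightarrow> (\<forall>i\<in>{0..<n} - A. bij (\<phi> i) \<and> Fq_linear_map K (\<phi> i)) \<and>
     (\<forall>c. \<forall>x\<in>C. (\<forall>i\<in>A. x i = 0) \<longrightarrow>
        (\<exists>y\<in>C. (\<forall>i\<in>A. y i = 0) \<and> (\<forall>i\<in>{0..<n} - A. \<phi> i (y i) = c * \<phi> i (x i))))"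

lemma linearizes_bij:
  assumes "linearizes A \<phi>" "i \<in> {0..<n} - A"
  shows "bij (\<phi> i)"
  using assms unfolding linearizes_def by blast

lemma linearizes_Fq_linear:
  assumes "linearizes A \<phi>" "i \<in> {0..<n} - A"
  shows "Fq_linear_map K (\<phi> i)"
  using assms unfolding linearizes_def by blast

lemma linearizes_eq_0_iff:
  assumes "linearizes A \<phi>" "i \<in> {0..<n} - A"
  shows "\<phi> i a = 0 \<longleftrightarrow> a = 0"
  using Fq_linear_map_0[OF linearizes_Fq_linear[OF assms]]
    inj_eq[OF bij_is_inj[OF linearizes_bij[OF assms]], of a 0] by simp

lemma linearizes_scale:
  assumes "linearizes A \<phi>" "x \<in> C" "\<forall>i\<in>A. x i = 0"
  obtains y where "y \<in> C" "\<forall>i\<in>A. y i = 0" "\<forall>i\<in>{0..<n} - A. \<phi> i (y i) = c * \<phi> i (x i)"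
  using assms unfolding linearizes_def by blast

text \<open>Scaling through \<open>\<phi>\<close> keeps zeros, because each \<open>\<phi> i\<close>
  is injective and fixes 0, so the scaled word still vanishes on the larger set. This brings both
  given linear structures to a common set of positions.\<close>

lemma linearizes_mono:
  assumes lin: "linearizes A \<phi>" and AS: "A \<subseteq> S" "S \<subseteq> {0..<n}"
  shows "linearizes S \<phi>"
  unfolding linearizes_def
proof (intro conjI allI ballI impI)
  fix c x assume x: "x \<in> C" "\<forall>i\<in>S. x i = 0"
  then obtain y where y: "y \<in> C" "\<forall>i\<in>A. y i = 0" "\<forall>i\<in>{0..<n} - A. \<phi> i (y i) = c * \<phi> i (x i)"
    using linearizes_scale[OF lin, of x c] AS by blast
  have "y i = 0" if "i \<in> S" for i
  proof (cases "i \<in> A")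
    case False
    then have i: "i \<in> {0..<n} - A" using that AS by auto
    then have "\<phi> i (y i) = 0"
      using y(3) x(2) that linearizes_eq_0_iff[OF lin i, of 0] by simp
    then show ?thesis using linearizes_eq_0_iff[OF lin i] by simp
  qed (use y in auto)
  then show "\<exists>y\<in>C. (\<forall>i\<in>S. y i = 0) \<and> (\<forall>i\<in>{0..<n} - S. \<phi> i (y i) = c * \<phi> i (x i))"
    using y AS by blast
next
  fix i assume "i \<in> {0..<n} - S"
  then have "i \<in> {0..<n} - A" using AS by blast
  then show "bij (\<phi> i)" "Fq_linear_map K (\<phi> i)"
    using linearizes_bij[OF lin] linearizes_Fq_linear[OF lin] by blast+
qed

section \<open>Comparison of two linear structures on the same shortened code\<close>

text \<open>For the linear structure given by \<open>\<phi>\<close>, the codewords vanishing on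
  \<open>S\<close> and at \<open>w\<close> are the scalar multiples of one word \<open>e\<close>, so
  their coordinates at \<open>i\<close> and \<open>u\<close>, read through \<open>\<phi>\<close>,
  are in a fixed ratio.\<close>

lemma linearizes_ratio:
  assumes lin: "linearizes S \<phi>" and S: "S \<subseteq> {0..<n}" "card S + 2 = k" "k \<le> n"
    and iuw: "i \<in> {0..<n} - S" "u \<in> {0..<n} - S" "w \<in> {0..<n} - S" "i \<noteq> u" "i \<noteq> w" "u \<noteq> w"
  obtains m where "m \<noteq> 0"
    "\<And>x. x \<in> C \<Longrightarrow> \<forall>j\<in>S. x j = 0 \<Longrightarrow> x w = 0 \<Longrightarrow> \<phi> i (x i) = m * \<phi> u (x u)"
proof -
  \<comment> \<open>This normalizes \<open>e\<close> to \<open>\<phi> u (e u) = 1\<close>, so that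
    the ratio is \<open>\<phi> i (e i)\<close>. It is nonzero, as \<open>e\<close> would otherwise
    vanish at \<open>k\<close> positions.\<close>
  obtain a where a: "\<phi> u a = 1"
    using surjD[OF bij_is_surj[OF linearizes_bij[OF lin iuw(2)]], of 1] by metis
  obtain e where e: "e \<in> C" "e u = a" "e w = 0" "\<forall>j\<in>S. e j = 0"
    using interpolate_point[OF S iuw(2,3,6), of a] .
  have "\<phi> i (x i) = \<phi> i (e i) * \<phi> u (x u)" if x: "x \<in> C" "\<forall>j\<in>S. x j = 0" "x w = 0" for x
  proof -
    obtain y where y: "y \<in> C" "\<forall>j\<in>S. y j = 0"
        "\<forall>j\<in>{0..<n} - S. \<phi> j (y j) = \<phi> u (x u) * \<phi> j (e j)"
      using linearizes_scale[OF lin e(1,4)] by blast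
    have "\<phi> u (y u) = \<phi> u (x u) * \<phi> u (e u)" using y(3) iuw(2) by blast
    then have "\<phi> u (y u) = \<phi> u (x u)" by (simp add: e(2) a)
    then have "y u = x u" by (rule injD[OF bij_is_inj[OF linearizes_bij[OF lin iuw(2)]]])
    moreover have "\<phi> w (y w) = \<phi> u (x u) * \<phi> w (e w)" using y(3) iuw(3) by blast
    then have "\<phi> w (y w) = 0" using linearizes_eq_0_iff[OF lin iuw(3), of 0] e(3) by simp
    then have "y w = 0" using linearizes_eq_0_iff[OF lin iuw(3)] by simp
    ultimately have "y = x"
      by (intro eqI_points[OF S(1,2) iuw(2,3,6) y(1,2) x(1,2)]) (simp_all add: x(3))
    moreover have "\<phi> i (y i) = \<phi> u (x u) * \<phi> i (e i)" using y(3) iuw(1) by blast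
    ultimately show ?thesis by (simp add: mult.commute)
  qed
  moreover have "\<phi> i (e i) \<noteq> 0"
  proof
    assume "\<phi> i (e i) = 0"
    then have "e i = 0" using linearizes_eq_0_iff[OF lin iuw(1)] by simp
    then have "e = (\<lambda>_. 0)"
      using zero_mem e(3) by (intro eqI_points[OF S(1,2) iuw(1,3,5) e(1,4)]) simp_all
    then have "a = 0" using e(2) by simp
    then show False using a linearizes_eq_0_iff[OF lin iuw(2), of a] by simp
  qed
  ultimately show ?thesis using that by blast
qed

text \<open>Both structures fix a ratio on the same words, and \<open>x u\<close> takes every value;
  eliminating \<open>x\<close> relates the transition maps at \<open>i\<close> and \<open>u\<close>
  up to scalars. The last conclusion keeps the same \<open>m\<close>, which later shows that
  different \<open>w\<close> give different constants.\<close>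

lemma two_linearizations_ratio:
  assumes lin: "linearizes S \<phi>" "linearizes S \<psi>"
    and S: "S \<subseteq> {0..<n}" "card S + 2 = k" "k \<le> n"
    and iuw: "i \<in> {0..<n} - S" "u \<in> {0..<n} - S" "w \<in> {0..<n} - S" "i \<noteq> u" "i \<noteq> w" "u \<noteq> w"
  obtains m m' where "m \<noteq> 0" "m' \<noteq> 0"
    "\<And>t. \<phi> i (inv (\<psi> i) (m' * t)) = m * \<phi> u (inv (\<psi> u) t)"
    "\<And>x. x \<in> C \<Longrightarrow> \<forall>j\<in>S. x j = 0 \<Longrightarrow> x w = 0 \<Longrightarrow> \<phi> i (x i) = m * \<phi> u (x u)"
proof -
  obtain m where m: "m \<noteq> 0"
    "\<And>x. x \<in> C \<Longrightarrow> \<forall>j\<in>S. x j = 0 \<Longrightarrow> x w = 0 \<Longrightarrow> \<phi> i (x i) = m * \<phi> u (x u)"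
    using linearizes_ratio[OF lin(1) S iuw] by metis
  obtain m' where m': "m' \<noteq> 0"
    "\<And>x. x \<in> C \<Longrightarrow> \<forall>j\<in>S. x j = 0 \<Longrightarrow> x w = 0 \<Longrightarrow> \<psi> i (x i) = m' * \<psi> u (x u)"
    using linearizes_ratio[OF lin(2) S iuw] by metis
  have "\<phi> i (inv (\<psi> i) (m' * t)) = m * \<phi> u (inv (\<psi> u) t)" for t
  proof -
    obtain x where x: "x \<in> C" "x u = inv (\<psi> u) t" "x w = 0" "\<forall>j\<in>S. x j = 0"
      using interpolate_point[OF S iuw(2,3,6)] .
    have "\<psi> u (x u) = t"
      using x linearizes_bij[OF lin(2) iuw(2)] by (simp add: bij_is_surj surj_f_inv_f)
    then have "m' * t = \<psi> i (x i)" using m'(2) x by simp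
    then have "inv (\<psi> i) (m' * t) = x i"
      using linearizes_bij[OF lin(2) iuw(1)] by (simp add: bij_is_inj)
    then show ?thesis using m(2) x by simp
  qed
  then show ?thesis using that m m' by blast
qed

text \<open>In the proof, \<open>r\<close> is the map \<open>\<rho>\<close>, and the quotients \<open>M j / M j0\<close> are the \<open>n - k\<close>
  distinct scalars in \<open>L\<close>.\<close>

lemma common_scalars:
  assumes linA: "linearizes A \<phi>" and linB: "linearizes B \<psi>"
    and AB: "A \<subseteq> {0..<n}" "B \<subseteq> {0..<n}" "A \<inter> B = {}" "card A + card B \<le> k - 2"
    and k: "2 \<le> k" "k < n"
  obtains L \<Phi> where "is_subfield L" "K \<subseteq> L" "n - k < card L"
    "\<And>i. i \<in> {0..<n} \<Longrightarrow> bij (\<Phi> i) \<and> Fq_linear_map K (\<Phi> i)"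
    "\<And>c x. c \<in> L \<Longrightarrow> x \<in> C \<Longrightarrow> \<exists>y\<in>C. \<forall>i\<in>{0..<n}. \<Phi> i (y i) = c * \<Phi> i (x i)"
proof -
  have finA: "finite A" and finB: "finite B" using AB finite_subset by blast+
  have "\<exists>S. A \<union> B \<subseteq> S \<and> S \<subseteq> {0..<n} \<and> card S = k - 2"
    using AB k finA finB
    by (intro exists_subset_between) (auto simp: card_Un_disjoint)
  then obtain S where S: "A \<union> B \<subseteq> S" "S \<subseteq> {0..<n}" "card S = k - 2" by blast
  have finS: "finite S" using S finite_subset by blast
  have cS: "card S + 2 = k" "k \<le> n" using S k by auto
  \<comment> \<open>\<open>B\<close> lies in \<open>S - A\<close> by disjointness. Working with
    \<open>A\<close> and \<open>S - A\<close> splits \<open>S\<close> into two parts, along which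
    codewords are decomposed below.\<close>
  have linB': "linearizes (S - A) \<psi>"
    by (rule linearizes_mono[OF linB]) (use S AB in auto)
  have lins: "linearizes S \<phi>" "linearizes S \<psi>"
    using linearizes_mono[OF linA _ S(2)] linearizes_mono[OF linB _ S(2)] S(1) by auto
  \<comment> \<open>Since \<open>k < n\<close>, at least three positions lie outside
    \<open>S\<close>: \<open>u\<close>, \<open>v\<close> and the \<open>n - k\<close> positions of
    \<open>J\<close>, each of which serves as the forced zero once.\<close>
  have card_out: "card ({0..<n} - S) = n - k + 2"
    using S k finS by (simp add: card_Diff_subset)
  then have "\<not> card ({0..<n} - S) \<le> Suc 0" by simp
  then obtain u v where uv: "u \<in> {0..<n} - S" "v \<in> {0..<n} - S" "u \<noteq> v"
    by (subst (asm) card_le_Suc0_iff_eq) auto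
  define J where "J = {0..<n} - S - {u, v}"
  have cJ: "card J = n - k"
    unfolding J_def using card_out uv by (subst card_Diff_subset) auto

  note bij\<phi> = linearizes_bij[OF linA] and bij\<psi> = linearizes_bij[OF linB']
  note lin\<phi> = linearizes_Fq_linear[OF linA] and lin\<psi> = linearizes_Fq_linear[OF linB']
  have inS: "i \<in> {0..<n} - A" "i \<in> {0..<n} - (S - A)" if "i \<in> {0..<n} - S" for i
    using that S by auto
  define r where "r t = \<phi> u (inv (\<psi> u) t)" for t
  have "Fq_linear_map K (inv (\<psi> u))"
    using bij\<psi> lin\<psi> inS(2)[OF uv(1)] by (blast intro: Fq_linear_map_inv)
  then have rK: "Fq_linear_map K r"
    using lin\<phi>[OF inS(1)[OF uv(1)]] by (simp add: Fq_linear_map_def r_def)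
  have radd: "r (s + t) = r s + r t" for s t using rK by (simp add: Fq_linear_map_def)
  have r0: "r 0 = 0" using rK by (rule Fq_linear_map_0)
  have rminus: "r (- t) = - r t" for t
    using radd[of t "- t"] r0 by (simp add: eq_neg_iff_add_eq_0 add.commute)
  have rbij: "bij r"
    using bij_comp[OF bij_imp_bij_inv[OF bij\<psi>[OF inS(2)[OF uv(1)]]] bij\<phi>[OF inS(1)[OF uv(1)]]]
    by (simp add: r_def[abs_def] comp_def)
  then have r_eq_0: "r t = 0 \<longleftrightarrow> t = 0" for t
    using r0 inj_eq[OF bij_is_inj, of r t 0] by simp

  \<comment> \<open>Membership of \<open>c\<close> means that conjugating multiplication by
    \<open>c\<close> with \<open>r\<close> gives multiplication by some \<open>c'\<close>. Field
    operations on such \<open>c\<close> are matched by the same operations on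
    \<open>c'\<close>.\<close>
  define L where "L = {c. \<exists>c'. \<forall>t. r (c' * t) = c * r t}"
  have LI: "c \<in> L" if "\<And>t. r (c' * t) = c * r t" for c c' using that by (auto simp: L_def)
  have L: "is_subfield L"
    unfolding is_subfield_def
  proof (intro conjI ballI)
    show "0 \<in> L" by (rule LI[of 0]) (simp add: r0)
    show "1 \<in> L" by (rule LI[of 1]) simp
  next
    fix c d assume "c \<in> L" "d \<in> L"
    then obtain c' d' where *: "\<And>t. r (c' * t) = c * r t" "\<And>t. r (d' * t) = d * r t"
      unfolding L_def by blast
    show "c + d \<in> L" by (rule LI[of "c' + d'"]) (simp add: distrib_right radd *)
    show "c * d \<in> L" by (rule LI[of "c' * d'"]) (simp add: mult.assoc *)
  next
    fix c assume "c \<in> L"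
    then obtain c' where *: "\<And>t. r (c' * t) = c * r t" unfolding L_def by blast
    show "- c \<in> L" by (rule LI[of "- c'"]) (simp add: rminus *)
    show "inverse c \<in> L"
    proof (cases "c = 0")
      case True
      then show ?thesis by (auto intro: LI[of 0] simp: r0)
    next
      case False
      have "c' \<noteq> 0" using *[of 1] False r_eq_0[of 1] r0 by auto
      have "r (inverse c' * t) = inverse c * r t" for t
        using *[of "inverse c' * t"] False \<open>c' \<noteq> 0\<close> by (simp add: field_simps)
      then show ?thesis by (rule LI)
    qed
  qed
  have KL: "K \<subseteq> L" using rK unfolding Fq_linear_map_def L_def by blast

  \<comment> \<open>Position \<open>v\<close> is compared with \<open>u\<close> along words that
    vanish at \<open>j\<close>, so the constants depend on \<open>j\<close> alone.\<close>
  define ratio where "ratio j m m' \<longleftrightarrow> m \<noteq> 0 \<and> m' \<noteq> 0 \<and>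
     (\<forall>t. \<phi> v (inv (\<psi> v) (m' * t)) = m * r t) \<and>
     (\<forall>x\<in>C. (\<forall>i\<in>S. x i = 0) \<longrightarrow> x j = 0 \<longrightarrow> \<phi> v (x v) = m * \<phi> u (x u))" for j m m'
  have "\<exists>m m'. ratio j m m'" if "j \<in> J" for j
  proof -
    have j: "j \<in> {0..<n} - S" "v \<noteq> j" "u \<noteq> j" using that by (auto simp: J_def)
    show ?thesis
    proof (rule two_linearizations_ratio[OF lins S(2) cS uv(2,1) j(1) uv(3)[symmetric] j(2,3)])
      fix m m' assume "m \<noteq> 0" "m' \<noteq> 0"
        "\<And>t. \<phi> v (inv (\<psi> v) (m' * t)) = m * \<phi> u (inv (\<psi> u) t)"
        "\<And>x. x \<in> C \<Longrightarrow> \<forall>i\<in>S. x i = 0 \<Longrightarrow> x j = 0 \<Longrightarrow> \<phi> v (x v) = m * \<phi> u (x u)"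
      then have "ratio j m m'" unfolding ratio_def r_def by blast
      then show "\<exists>m m'. ratio j m m'" by blast
    qed
  qed
  then obtain M M' where ratio: "\<And>j. j \<in> J \<Longrightarrow> ratio j (M j) (M' j)"
    by metis
  have M: "M j \<noteq> 0" "M' j \<noteq> 0" "\<phi> v (inv (\<psi> v) (M' j * t)) = M j * r t"
    "x \<in> C \<Longrightarrow> \<forall>i\<in>S. x i = 0 \<Longrightarrow> x j = 0 \<Longrightarrow> \<phi> v (x v) = M j * \<phi> u (x u)"
    if "j \<in> J" for j t x
    using ratio[OF that] unfolding ratio_def by blast+
  have "J \<noteq> {}" using cJ k by auto
  then obtain j0 where j0: "j0 \<in> J" by blast
  \<comment> \<open>If \<open>j\<close> and \<open>l\<close> had equal constants, the words with
    value 1 at \<open>u\<close> and zero at \<open>j\<close> or at \<open>l\<close> would agree at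
    \<open>u\<close> and \<open>v\<close>. They would coincide, vanish at both \<open>j\<close> and
    \<open>l\<close>, and thus be zero.\<close>
  have "inj_on M J"
  proof (rule inj_onI, rule ccontr)
    fix j l assume jl: "j \<in> J" "l \<in> J" "M j = M l" "j \<noteq> l"
    have ex: "\<exists>x\<in>C. x u = 1 \<and> x w = 0 \<and> (\<forall>i\<in>S. x i = 0)" if "w \<in> J" for w
    proof -
      have "w \<in> {0..<n} - S" "u \<noteq> w" using that by (auto simp: J_def)
      from interpolate_point[OF S(2) cS uv(1) this] show ?thesis by metis
    qed
    obtain x where x: "x \<in> C" "x u = 1" "x j = 0" "\<forall>i\<in>S. x i = 0" using ex[OF jl(1)] by blast
    obtain y where y: "y \<in> C" "y u = 1" "y l = 0" "\<forall>i\<in>S. y i = 0" using ex[OF jl(2)] by blast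
    have "\<phi> v (x v) = \<phi> v (y v)"
      using M(4)[OF jl(1) x(1,4,3)] M(4)[OF jl(2) y(1,4,3)] x(2) y(2) jl(3) by simp
    then have "x v = y v" by (rule injD[OF bij_is_inj[OF bij\<phi>[OF inS(1)[OF uv(2)]]]])
    then have "x = y"
      using x(2) y(2) by (intro eqI_points[OF S(2) cS(1) uv x(1,4) y(1,4)]) simp_all
    have "j \<in> {0..<n} - S" "l \<in> {0..<n} - S" using jl by (auto simp: J_def)
    then have "x = (\<lambda>_. 0)"
      using x(3) y(3) \<open>x = y\<close> zero_mem
      by (intro eqI_points[OF S(2) cS(1) _ _ jl(4) x(1,4)]) simp_all
    then show False using x(2) by simp
  qed
  then have inj: "inj_on (\<lambda>j. M j / M j0) J"
    using M(1)[OF j0] by (auto simp: inj_on_def)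
  \<comment> \<open>The transition map at \<open>v\<close> does not depend on \<open>j\<close>, so
    it can be eliminated between the identities for \<open>j\<close> and \<open>j0\<close>.\<close>
  have quot_L: "M j / M j0 \<in> L" if "j \<in> J" for j
  proof (rule LI[of "M' j / M' j0"])
    fix t
    have "M j * r t = \<phi> v (inv (\<psi> v) (M' j0 * (M' j / M' j0 * t)))"
      using M(3)[OF that, of t] M(2)[OF j0] by simp
    also have "\<dots> = M j0 * r (M' j / M' j0 * t)" using M(3)[OF j0] .
    finally show "r (M' j / M' j0 * t) = M j / M j0 * r t"
      using M(1)[OF j0] by (simp add: field_simps)
  qed
  \<comment> \<open>Adding 0, which is not a quotient, to the \<open>n - k\<close> quotients makes
    the bound strict.\<close>
  have "card (insert 0 ((\<lambda>j. M j / M j0) ` J)) \<le> card L"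
    using quot_L L by (intro card_mono) (auto simp: is_subfield_def)
  moreover have "0 \<notin> (\<lambda>j. M j / M j0) ` J" using M(1) j0 by auto
  ultimately have cL: "n - k < card L"
    using cJ card_image[OF inj] by (simp add: J_def)

  \<comment> \<open>On \<open>A\<close> the hypothesis on \<open>\<phi>\<close> says nothing, so
    \<open>\<psi>\<close> is used there; composing it with \<open>r\<close> turns multiplication by
    \<open>c'\<close> into multiplication by \<open>c\<close>.\<close>
  define \<Phi> where "\<Phi> i = (if i \<in> A then r \<circ> \<psi> i else \<phi> i)" for i
  have \<Phi>: "bij (\<Phi> i) \<and> Fq_linear_map K (\<Phi> i)" if "i \<in> {0..<n}" for i
  proof (cases "i \<in> A")
    case True
    then have i: "i \<in> {0..<n} - (S - A)" using that by auto
    show ?thesis using True bij_comp[OF bij\<psi>[OF i] rbij] lin\<psi>[OF i] rK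
      by (simp add: \<Phi>_def Fq_linear_map_def)
  next
    case False
    then show ?thesis using that bij\<phi> lin\<phi> by (simp add: \<Phi>_def)
  qed
  have \<Phi>add: "\<Phi> i (a + b) = \<Phi> i a + \<Phi> i b" if "i \<in> {0..<n}" for i a b
    using \<Phi>[OF that] by (simp add: Fq_linear_map_def)
  have \<Phi>0: "\<Phi> i 0 = 0" if "i \<in> {0..<n}" for i
    using \<Phi>[OF that] Fq_linear_map_0 by blast
  \<comment> \<open>The definition of \<open>L\<close> concerns position \<open>u\<close> only. The
    ratio identity carries it to every position outside \<open>S\<close>, a third such position
    providing the zero.\<close>
  have commute: "\<phi> i (inv (\<psi> i) (c' * t)) = c * \<phi> i (inv (\<psi> i) t)"
    if c: "\<And>t. r (c' * t) = c * r t" and i: "i \<in> {0..<n} - S" for c c' i t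
  proof (cases "i = u")
    case True
    then show ?thesis using c by (simp add: r_def)
  next
    case False
    have "\<not> {0..<n} - S \<subseteq> {i, u}"
    proof
      assume "{0..<n} - S \<subseteq> {i, u}"
      then have "card ({0..<n} - S) \<le> card {i, u}" by (intro card_mono) auto
      also have "\<dots> \<le> 2" by (simp add: card_insert_if)
      finally show False using card_out k by simp
    qed
    then obtain w where w: "w \<in> {0..<n} - S" "i \<noteq> w" "u \<noteq> w" by blast
    obtain m m' where m: "m' \<noteq> 0" "\<And>t. \<phi> i (inv (\<psi> i) (m' * t)) = m * r t"
      using two_linearizations_ratio[OF lins S(2) cS i uv(1) w(1) False w(2,3)]
      unfolding r_def by metis
    have "\<phi> i (inv (\<psi> i) (c' * t)) = \<phi> i (inv (\<psi> i) (m' * (c' * (t / m'))))"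
      using m(1) by (simp add: field_simps)
    also have "\<dots> = m * r (c' * (t / m'))" by (rule m(2))
    also have "\<dots> = c * (m * r (t / m'))" by (simp only: c mult.left_commute)
    also have "\<dots> = c * \<phi> i (inv (\<psi> i) (m' * (t / m')))" by (simp only: m(2))
    finally show ?thesis using m(1) by simp
  qed
  have "\<exists>y\<in>C. \<forall>i\<in>{0..<n}. \<Phi> i (y i) = c * \<Phi> i (x i)" if c: "c \<in> L" and x: "x \<in> C" for c x
  proof -
    obtain c' where c': "\<And>t. r (c' * t) = c * r t" using c unfolding L_def by blast
    \<comment> \<open>This splits \<open>x = y + z\<close> with \<open>y\<close> zero on
      \<open>A\<close> and \<open>z\<close> zero on \<open>S - A\<close>. Then \<open>y\<close> is
      scaled by \<open>c\<close> through \<open>\<phi>\<close> and \<open>z\<close> by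
      \<open>c'\<close> through \<open>\<psi>\<close>; through \<open>\<Phi>\<close> both appear as
      scaling by \<open>c\<close>.\<close>
    have "\<exists>y\<in>C. \<forall>i\<in>S. y i = (if i \<in> A then 0 else x i)"
      using S cS by (intro interpolate) auto
    then obtain y where y: "y \<in> C" "\<And>i. i \<in> S \<Longrightarrow> y i = (if i \<in> A then 0 else x i)" by blast
    define z where "z i = x i - y i" for i
    have z: "z \<in> C" "\<forall>i\<in>S - A. z i = 0"
      using minus_closed[OF x y(1)] y(2) by (auto simp: z_def[abs_def])
    have yA: "\<forall>i\<in>A. y i = 0" using y(2) S by auto
    obtain y' where y': "y' \<in> C" "\<forall>i\<in>A. y' i = 0" "\<forall>i\<in>{0..<n} - A. \<phi> i (y' i) = c * \<phi> i (y i)"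
      using linearizes_scale[OF linA y(1) yA] by blast
    obtain z' where z': "z' \<in> C" "\<forall>i\<in>S - A. z' i = 0"
        "\<forall>i\<in>{0..<n} - (S - A). \<psi> i (z' i) = c' * \<psi> i (z i)"
      using linearizes_scale[OF linB' z] by blast
    show ?thesis
    proof (rule bexI[OF _ add_closed[OF y'(1) z'(1)]], rule ballI)
      fix i assume i: "i \<in> {0..<n}"
      have Y: "\<Phi> i (y' i) = c * \<Phi> i (y i)"
        using i yA y' by (cases "i \<in> A") (simp_all add: \<Phi>0, simp add: \<Phi>_def)
      have Z: "\<Phi> i (z' i) = c * \<Phi> i (z i)"
      proof -
        consider "i \<in> A" | "i \<in> S - A" | "i \<in> {0..<n} - S" using i by auto
        then show ?thesis
        proof cases
          case 1
          then show ?thesis using z'(3) i c' by (simp add: \<Phi>_def)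
        next
          case 2
          then show ?thesis using z z' i \<Phi>0 by simp
        next
          case 3
          note b = bij_is_inj[OF bij\<psi>[OF inS(2)[OF 3]]]
          have "\<phi> i (z' i) = \<phi> i (inv (\<psi> i) (\<psi> i (z' i)))" using b by simp
          also have "\<dots> = c * \<phi> i (inv (\<psi> i) (\<psi> i (z i)))"
            using z'(3) inS(2)[OF 3] commute[OF c' 3] by simp
          finally show ?thesis using b 3 S by (auto simp: \<Phi>_def)
        qed
      qed
      have "x i = y i + z i" by (simp add: z_def)
      then show "\<Phi> i (y' i + z' i) = c * \<Phi> i (x i)"
        using Y Z i by (simp add: \<Phi>add distrib_left)
    qed
  qed
  from that[OF L KL cL \<Phi> this] show ?thesis .
qed

end

section \<open>From code parameters and equivalences to linear structures and back\<close>

text \<open>A nonzero word with \<open>k\<close> zeros would have weight below the minimum distance.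
  Hence restriction to \<open>k\<close> positions is injective, and the number of codewords makes it
  onto.\<close>

lemma mds_code_of_is_code:
  fixes C :: "(nat \<Rightarrow> 'a::{field,finite}) set"
  assumes lin: "lin_code (subfield_ord q) {0..<n} C"
    and K: "is_subfield (subfield_ord q :: 'a set)"
    and card: "card (UNIV :: 'a set) = q ^ h"
    and mds: "is_code {0..<n} C (q ^ (h * k)) (n - k + 1)"
  shows "mds_code (subfield_ord q) n k C"
proof -
  have add: "(\<lambda>i. x i + y i) \<in> C" if "x \<in> C" "y \<in> C" for x y
    using lin that by (simp add: lin_code_def)
  have scale: "(\<lambda>i. c * x i) \<in> C" if "c \<in> subfield_ord q" "x \<in> C" for c x
    using lin that by (simp add: lin_code_def)
  have zero: "(\<lambda>_. 0) \<in> C" and sub: "C \<subseteq> words {0..<n}"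
    using lin by (simp_all add: lin_code_def)
  have minus: "(\<lambda>i. x i - y i) \<in> C" if "x \<in> C" "y \<in> C" for x y
  proof -
    have "- 1 \<in> (subfield_ord q :: 'a set)" using K by (simp add: is_subfield_def)
    from add[OF that(1) scale[OF this that(2)]] show ?thesis by simp
  qed
  have eq_zero: "x = (\<lambda>_. 0)"
    if x: "x \<in> C" and S: "S \<subseteq> {0..<n}" "k \<le> card S" "\<forall>i\<in>S. x i = 0" for x S
  proof (rule ccontr)
    assume nz: "x \<noteq> (\<lambda>_. 0)"
    let ?D = "{hdist {0..<n} x y | x y. x \<in> C \<and> y \<in> C \<and> x \<noteq> y}"
    have "hdist {0..<n} x y \<le> n" for x y :: "nat \<Rightarrow> 'a"
      unfolding hdist_def by (rule order_trans[OF card_mono[of "{0..<n}"]]) auto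
    then have "?D \<subseteq> {0..n}" by auto
    then have "finite ?D" by (rule finite_subset) simp
    moreover have "hdist {0..<n} x (\<lambda>_. 0) \<in> ?D" using x zero nz by blast
    ultimately have "min_dist {0..<n} C \<le> hdist {0..<n} x (\<lambda>_. 0)"
      unfolding min_dist_def by (rule Min_le)
    then have "n - k + 1 \<le> hdist {0..<n} x (\<lambda>_. 0)"
      using mds by (simp add: is_code_def)
    also have "\<dots> \<le> card ({0..<n} - S)"
      unfolding hdist_def using S by (intro card_mono) auto
    also have "\<dots> = n - card S"
      using S by (simp add: card_Diff_subset finite_subset[OF S(1)])
    finally show False using S(2) by linarith
  qed
  have interpolate_k: "\<exists>x\<in>C. \<forall>i\<in>S. x i = t i" if S: "S \<subseteq> {0..<n}" "card S = k" for S t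
  proof -
    let ?R = "\<lambda>x. restrict x S"
    have fin: "finite S" using S finite_subset by blast
    have "inj_on ?R C"
    proof (rule inj_onI)
      fix x y assume xy: "x \<in> C" "y \<in> C" "?R x = ?R y"
      then have "x i = y i" if "i \<in> S" for i using that by (metis restrict_apply')
      then show "x = y"
        using eq_zero[OF minus[OF xy(1,2)] S(1)] S(2) by (auto simp: fun_eq_iff)
    qed
    then have "card (?R ` C) = q ^ (h * k)"
      using mds by (simp add: card_image is_code_def)
    also have "\<dots> = card (S \<rightarrow>\<^sub>E (UNIV :: 'a set))"
      using S fin card by (simp add: card_funcsetE power_mult)
    finally have "?R ` C = S \<rightarrow>\<^sub>E UNIV"
      using fin by (intro card_subset_eq finite_PiE) auto
    then have "restrict t S \<in> ?R ` C" by auto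
    then obtain x where "x \<in> C" "?R t = ?R x" by auto
    then show ?thesis by (metis restrict_apply')
  qed
  have interpolate: "\<exists>x\<in>C. \<forall>i\<in>S. x i = t i" if S: "S \<subseteq> {0..<n}" "card S \<le> k" "k \<le> n" for S t
  proof -
    have "\<exists>S'. S \<subseteq> S' \<and> S' \<subseteq> {0..<n} \<and> card S' = k"
      using S by (intro exists_subset_between) auto
    then obtain S' where S': "S \<subseteq> S'" "S' \<subseteq> {0..<n}" "card S' = k" by blast
    show ?thesis using interpolate_k[OF S'(2,3), of t] S'(1) by blast
  qed
  show ?thesis
  proof (rule mds_code.intro)
    show "(\<lambda>i. x i - y i) \<in> C" if "x \<in> C" "y \<in> C" for x y using that by (rule minus)
    show "x = (\<lambda>_. 0)" if "x \<in> C" "S \<subseteq> {0..<n}" "k \<le> card S" "\<forall>i\<in>S. x i = 0" for x S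
      using that by (rule eq_zero)
    show "\<exists>x\<in>C. \<forall>i\<in>S. x i = t i" if "S \<subseteq> {0..<n}" "card S \<le> k" "k \<le> n" for S t
      using that by (rule interpolate)
  qed (rule lin)
qed

text \<open>Scalar multiplication in \<open>D\<close> is pulled back to the projected code. With
  \<open>\<tau>\<close> inverse to \<open>\<sigma>\<close>, the bijection acting on position
  \<open>i\<close> of a codeword is \<open>\<phi> (\<tau> i)\<close>.\<close>

lemma (in mds_code) linearizes_of_code_equiv:
  assumes "\<exists>D. lin_code UNIV ({0..<n} - A) D \<and> code_equiv K ({0..<n} - A) (proj A C) D"
  shows "\<exists>\<phi>. linearizes A \<phi>"
proof -
  let ?I = "{0..<n} - A"
  obtain D \<sigma> \<phi> where D: "lin_code UNIV ?I D" and \<sigma>: "bij_betw \<sigma> ?I ?I"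
      and \<phi>: "\<forall>i\<in>?I. bij (\<phi> i) \<and> Fq_linear_map K (\<phi> i)"
      and D_eq: "D = (\<lambda>x. \<lambda>j. if j \<in> ?I then \<phi> j (x (\<sigma> j)) else 0) ` proj A C"
    using assms unfolding code_equiv_def by blast
  define \<tau> where "\<tau> = inv_into ?I \<sigma>"
  have \<tau>: "\<tau> i \<in> ?I" "\<sigma> (\<tau> i) = i" if "i \<in> ?I" for i
    using that \<sigma> unfolding \<tau>_def
    by (metis bij_betw_apply bij_betw_inv_into, metis bij_betw_inv_into_right)
  have "linearizes A (\<lambda>i. \<phi> (\<tau> i))"
    unfolding linearizes_def
  proof (intro conjI allI ballI impI)
    fix c x assume x: "x \<in> C" "\<forall>i\<in>A. x i = 0"
    let ?f = "\<lambda>x j. if j \<in> ?I then \<phi> j (x (\<sigma> j)) else 0"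
    have "?f x \<in> D" unfolding D_eq using x by (intro imageI) (simp add: proj_def)
    then have "(\<lambda>j. c * ?f x j) \<in> D"
      using D by (simp add: lin_code_def)
    then obtain y where y: "y \<in> proj A C" "(\<lambda>j. c * ?f x j) = ?f y"
      unfolding D_eq by blast
    have "\<phi> (\<tau> i) (y i) = c * \<phi> (\<tau> i) (x i)" if "i \<in> ?I" for i
      using fun_cong[OF y(2), of "\<tau> i"] \<tau>[OF that] by simp
    then show "\<exists>y\<in>C. (\<forall>i\<in>A. y i = 0) \<and> (\<forall>i\<in>?I. \<phi> (\<tau> i) (y i) = c * \<phi> (\<tau> i) (x i))"
      using y(1) by (auto simp: proj_def)
  qed (use \<phi> \<tau> in blast)+
  then show ?thesis by blast
qed

text \<open>The witness is the image of \<open>C\<close> under \<open>\<Phi>\<close> with the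
  identity permutation; \<open>scale\<close> says exactly that this image is closed under scalars
  from \<open>L\<close>.\<close>

lemma (in mds_code) code_equiv_lin_code:
  assumes \<Phi>: "\<And>i. i \<in> {0..<n} \<Longrightarrow> bij (\<Phi> i) \<and> Fq_linear_map K (\<Phi> i)"
    and scale: "\<And>c x. c \<in> L \<Longrightarrow> x \<in> C \<Longrightarrow> \<exists>y\<in>C. \<forall>i\<in>{0..<n}. \<Phi> i (y i) = c * \<Phi> i (x i)"
  shows "\<exists>D. lin_code L {0..<n} D \<and> code_equiv K {0..<n} C D"
proof -
  let ?f = "\<lambda>x j. if j \<in> {0..<n} then \<Phi> j (x (id j)) else 0"
  have "lin_code L {0..<n} (?f ` C)"
    unfolding lin_code_def
  proof (intro conjI ballI)
    show "?f ` C \<subseteq> words {0..<n}" by (auto simp: words_def)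
    have "\<Phi> i 0 = 0" if "i \<in> {0..<n}" for i
      using \<Phi>[OF that] Fq_linear_map_0 by blast
    then have "(\<lambda>_. 0) = ?f (\<lambda>_. 0)" by auto
    then show "(\<lambda>_. 0) \<in> ?f ` C" using zero_mem by (rule image_eqI)
  next
    fix a b assume "a \<in> ?f ` C" "b \<in> ?f ` C"
    then obtain x y where xy: "x \<in> C" "a = ?f x" "y \<in> C" "b = ?f y" by blast
    have "\<Phi> i (x i + y i) = \<Phi> i (x i) + \<Phi> i (y i)" if "i \<in> {0..<n}" for i
      using \<Phi>[OF that] by (simp add: Fq_linear_map_def)
    then have "(\<lambda>i. a i + b i) = ?f (\<lambda>i. x i + y i)"
      unfolding xy(2,4) by auto
    then show "(\<lambda>i. a i + b i) \<in> ?f ` C" using add_closed[OF xy(1,3)] by (rule image_eqI)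
  next
    fix c a assume "c \<in> L" "a \<in> ?f ` C"
    then obtain x where x: "x \<in> C" "a = ?f x" by blast
    obtain y where y: "y \<in> C" "\<forall>i\<in>{0..<n}. \<Phi> i (y i) = c * \<Phi> i (x i)"
      using scale[OF \<open>c \<in> L\<close> x(1)] by blast
    then have "(\<lambda>i. c * a i) = ?f y" unfolding x(2) by auto
    then show "(\<lambda>i. c * a i) \<in> ?f ` C" using y(1) by (rule image_eqI)
  qed
  moreover have "code_equiv K {0..<n} C (?f ` C)"
    unfolding code_equiv_def
  proof (intro exI[of _ id] exI[of _ \<Phi>] conjI ballI)
    show "bij_betw id {0..<n} {0..<n}" by simp
  qed (use \<Phi> in blast)+
  ultimately show ?thesis by blast
qed

theorem theorem1p2:
  fixes q h k n :: nat and C :: "(nat \<Rightarrow> 'a::{field,finite}) set" and A B :: "nat set"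
  assumes q: "prime_power q" and h: "h \<ge> 1" and k: "k > 3"
    and card_field: "card (UNIV :: 'a set) = q ^ h"
    and lin: "lin_code (subfield_ord q) {0..<n} C"
    and mds: "is_code {0..<n} C (q ^ (h * k)) (n - k + 1)"
    and AB: "A \<subseteq> {0..<n}" "B \<subseteq> {0..<n}" "A \<inter> B = {}" "card A + card B \<le> k - 2"
    and projA: "\<exists>D. lin_code UNIV ({0..<n} - A) D
                 \<and> code_equiv (subfield_ord q) ({0..<n} - A) (proj A C) D"
    and projB: "\<exists>D. lin_code UNIV ({0..<n} - B) D
                 \<and> code_equiv (subfield_ord q) ({0..<n} - B) (proj B C) D"
  shows "(n > q + k \<longrightarrow> (\<exists>s. s dvd h \<and> s > 1 \<and>
            (\<exists>D. lin_code (subfield_ord (q ^ s)) {0..<n} D \<and>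
                 code_equiv (subfield_ord q) {0..<n} C D)))
       \<and> (\<forall>e. e dvd h \<and> e < h \<and> (\<forall>d. d dvd h \<and> d < h \<longrightarrow> d \<le> e) \<longrightarrow>
            n > q ^ e + k \<longrightarrow>
            (\<exists>D. lin_code UNIV {0..<n} D \<and> code_equiv (subfield_ord q) {0..<n} C D))"
proof -
  have K: "is_subfield (subfield_ord q :: 'a set)" by (rule subfield_ord_subfield[OF q card_field])
  interpret mds_code "subfield_ord q" n k C
    by (rule mds_code_of_is_code[OF lin K card_field mds])
  obtain \<phi> \<psi> where \<phi>\<psi>: "linearizes A \<phi>" "linearizes B \<psi>"
    using linearizes_of_code_equiv[OF projA] linearizes_of_code_equiv[OF projB] by blast
  \<comment> \<open>Both claims follow from one bound: \<open>C\<close> is equivalent to a code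
    linear over a subfield of order \<open>q ^ s > n - k\<close>.\<close>
  have main: "\<exists>s. s dvd h \<and> n - k < q ^ s \<and>
      (\<exists>D. lin_code (subfield_ord (q ^ s)) {0..<n} D \<and> code_equiv (subfield_ord q) {0..<n} C D)"
    if "k < n"
  proof -
    have "2 \<le> k" using k by simp
    from common_scalars[OF \<phi>\<psi> AB this that] obtain L \<Phi> where L: "is_subfield L" "subfield_ord q \<subseteq> L"
        "n - k < card L"
      and \<Phi>: "\<And>i. i \<in> {0..<n} \<Longrightarrow> bij (\<Phi> i) \<and> Fq_linear_map (subfield_ord q) (\<Phi> i)"
        "\<And>c x. c \<in> L \<Longrightarrow> x \<in> C \<Longrightarrow> \<exists>y\<in>C. \<forall>i\<in>{0..<n}. \<Phi> i (y i) = c * \<Phi> i (x i)"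
      by blast
    obtain s where "s dvd h" "card L = q ^ s" "L = subfield_ord (q ^ s)"
      by (rule subfield_eq_subfield_ord[OF q h card_field L(1,2)])
    moreover have "\<exists>D. lin_code L {0..<n} D \<and> code_equiv (subfield_ord q) {0..<n} C D"
      by (rule code_equiv_lin_code[OF \<Phi>])
    ultimately show ?thesis using L(3) by auto
  qed
  have q1: "1 \<le> q"
    using prime_power_ge_2[OF q] by simp
  show ?thesis
  proof (intro conjI impI allI)
    assume n: "n > q + k"
    then obtain s where s: "s dvd h" "n - k < q ^ s"
        "\<exists>D. lin_code (subfield_ord (q ^ s)) {0..<n} D \<and> code_equiv (subfield_ord q) {0..<n} C D"
      using main by auto
    \<comment> \<open>From \<open>q < n - k < q ^ s\<close>; this excludes \<open>s = 0\<close> as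
      well.\<close>
    have "\<not> s \<le> 1"
    proof
      assume "s \<le> 1"
      then have "q ^ s \<le> q ^ 1" using q1 by (rule power_increasing)
      then show False using s(2) n by simp
    qed
    then show "\<exists>s. s dvd h \<and> s > 1 \<and>
        (\<exists>D. lin_code (subfield_ord (q ^ s)) {0..<n} D \<and> code_equiv (subfield_ord q) {0..<n} C D)"
      using s by (intro exI[of _ s]) auto
  next
    fix e assume e: "e dvd h \<and> e < h \<and> (\<forall>d. d dvd h \<and> d < h \<longrightarrow> d \<le> e)" and n: "n > q ^ e + k"
    then obtain s where s: "s dvd h" "n - k < q ^ s"
        "\<exists>D. lin_code (subfield_ord (q ^ s)) {0..<n} D \<and> code_equiv (subfield_ord q) {0..<n} C D"
      using main by auto
    \<comment> \<open>A divisor of \<open>h\<close> exceeding the largest proper one is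
      \<open>h\<close> itself, and then the subfield is the whole field.\<close>
    have "\<not> s \<le> e"
    proof
      assume "s \<le> e"
      then have "q ^ s \<le> q ^ e" using q1 by (rule power_increasing)
      then show False using s(2) n by simp
    qed
    moreover have "s \<le> h" using s(1) h by (intro dvd_imp_le) auto
    ultimately have "s = h" using e s(1) by (metis le_neq_implies_less)
    moreover have "subfield_ord (q ^ h) = (UNIV :: 'a set)"
      using power_card_subfield[OF subfield_UNIV[where 'a = 'a]] card_field
      by (simp add: subfield_ord_def)
    ultimately show "\<exists>D. lin_code UNIV {0..<n} D \<and> code_equiv (subfield_ord q) {0..<n} C D"
      using s(3) by simp
  qed
qed

end
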